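(* Let $m\ge1$, let $\Lambda=(\lambda_1,\ldots,\lambda_n)\subset\mathbb{R}^{4m}$ be an admissible configuration whose affine span is $\mathbb{R}^{4m}$, and let $P=P_\Lambda$. There is an $\operatorname{Sp}(1)^n$-equivariant homeomorphism $$Z_{\mathbb H}(\Lambda)\cong(D^4,\mathbb{S}^3)^{K_P},$$ where an indispensable coordinate is represented by a ghost vertex of $K_P$ and hence contributes an $\mathbb{S}^3$ factor.
   Context: $\mathbb{H}$ denotes the quaternions, $\operatorname{Sp}(1)=\mathbb{S}^3$ the unit quaternions, $D^4\subset\mathbb{H}$ the closed unit ball, $[n]=\{1,\ldots,n\}$. A configuration $\Lambda=(\lambda_1,\ldots,\lambda_n)\subset\mathbb{R}^{4m}$ is admissible if $0\in\operatorname{conv}\{\lambda_1,\ldots,\lambda_n\}$ and, for every $I\subset[n]$, $0\in\operatorname{conv}\{\lambda_i:i\in I\}$ implies $|I|>4m$. Define $$Z_{\mathbb H}(\Lambda)=\Big\{q\in\mathbb{H}^n:\ \sum_i\lambda_i|q_i|^2=0,\ \sum_i|q_i|^2=1\Big\},\qquad P_\Lambda=\Big\{x\in\mathbb{R}_{\ge0}^n:\ \sum_i\lambda_ix_i=0,\ \sum_ix_i=1\Big\}.$$ A coordinate $i$ is indispensable if $x_i>0$ on all of $P_\Lambda$. The simplicial complex $K_P$ on $[n]$ is defined by: $J\in K_P$ if and only if $P\cap\{x_j=0:j\in J\}\ne\varnothing$. A ghost vertex is an $i\in[n]$ with $\{i\}\notin K_P$. For a simplicial complex $K$ on $[n]$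 and a pair $(X,A)$, the polyhedral product is $$(X,A)^K=\bigcup_{\sigma\in K}\prod_{i=1}^nY_i(\sigma),\qquad Y_i(\sigma)=X\text{ if }i\in\sigma,\quad Y_i(\sigma)=A\text{ if }i\notin\sigma.$$ The group $\operatorname{Sp}(1)^n$ acts on both sides by coordinatewise right multiplication $(q_i)_i\cdot(u_i)_i=(q_iu_i)_i$. *)

theory Defs
  imports "HOL-Analysis.Analysis"
begin

section \<open>The quaternions as a real normed division algebra\<close>

datatype quat = Quat (qRe: real) (qI: real) (qJ: real) (qK: real)

lemma quat_eq_iff:
  "x = y \<longleftrightarrow> qRe x = qRe y \<and> qI x = qI y \<and> qJ x = qJ y \<and> qK x = qK y"
  by (cases x; cases y) simp

instantiation quat :: ab_group_add
begin

definition "0 = Quat 0 0 0 0"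
definition "x + y = Quat (qRe x + qRe y) (qI x + qI y) (qJ x + qJ y) (qK x + qK y)"
definition "- x = Quat (- qRe x) (- qI x) (- qJ x) (- qK x)"
definition "x - y = Quat (qRe x - qRe y) (qI x - qI y) (qJ x - qJ y) (qK x - qK y)"

instance
  by standard
    (simp_all add: quat_eq_iff zero_quat_def plus_quat_def uminus_quat_def minus_quat_def)

end

lemma quat_group_sel [simp]:
  "qRe 0 = 0" "qI 0 = 0" "qJ 0 = 0" "qK 0 = 0"
  "qRe (x + y) = qRe x + qRe y" "qI (x + y) = qI x + qI y"
  "qJ (x + y) = qJ x + qJ y" "qK (x + y) = qK x + qK y"
  "qRe (- x) = - qRe x" "qI (- x) = - qI x" "qJ (- x) = - qJ x" "qK (- x) = - qK x"
  "qRe (x - y) = qRe x - qRe y" "qI (x - y) = qI x - qI y"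
  "qJ (x - y) = qJ x - qJ y" "qK (x - y) = qK x - qK y"
  by (simp_all add: zero_quat_def plus_quat_def uminus_quat_def minus_quat_def)

instantiation quat :: real_vector
begin

definition "scaleR r x = Quat (r * qRe x) (r * qI x) (r * qJ x) (r * qK x)"

instance
  by standard (simp_all add: quat_eq_iff scaleR_quat_def algebra_simps)

end

lemma quat_scaleR_sel [simp]:
  "qRe (r *\<^sub>R x) = r * qRe x" "qI (r *\<^sub>R x) = r * qI x"
  "qJ (r *\<^sub>R x) = r * qJ x" "qK (r *\<^sub>R x) = r * qK x"
  by (simp_all add: scaleR_quat_def)

instantiation quat :: real_inner
begin

definition "inner x y = qRe x * qRe y + qI x * qI y + qJ x * qJ y + qK x * qK y"
definition "norm (x :: quat) = sqrt (inner x x)"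
definition "sgn (x :: quat) = x /\<^sub>R norm x"
definition "dist (x :: quat) y = norm (x - y)"
definition "(uniformity :: (quat \<times> quat) filter)
  = (INF e\<in>{0 <..}. principal {(x, y). dist x y < e})"
definition "open (U :: quat set)
  \<longleftrightarrow> (\<forall>x\<in>U. eventually (\<lambda>(x', y). x' = x \<longrightarrow> y \<in> U) uniformity)"

instance
proof
  fix x y z :: quat and r :: real and U :: "quat set"
  show "inner x y = inner y x"
    "inner (x + y) z = inner x z + inner y z"
    "inner (r *\<^sub>R x) y = r * inner x y"
    by (simp_all add: inner_quat_def algebra_simps)
  show "0 \<le> inner x x"
    by (simp add: inner_quat_def)
  show "(inner x x = 0) = (x = 0)"
    by (simp add: inner_quat_def quat_eq_iff add_nonneg_eq_0_iff)
  show "norm x = sqrt (inner x x)" "sgn x = x /\<^sub>R norm x" "dist x y = norm (x - y)"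
    "(uniformity :: (quat \<times> quat) filter) = (INF e\<in>{0 <..}. principal {(x, y). dist x y < e})"
    "open U \<longleftrightarrow> (\<forall>x\<in>U. eventually (\<lambda>(x', y). x' = x \<longrightarrow> y \<in> U) uniformity)"
    by (fact norm_quat_def sgn_quat_def dist_quat_def uniformity_quat_def open_quat_def)+
qed

end

lemma norm_quat_squared:
  "(norm (x :: quat))\<^sup>2 = (qRe x)\<^sup>2 + (qI x)\<^sup>2 + (qJ x)\<^sup>2 + (qK x)\<^sup>2"
  unfolding power2_norm_eq_inner inner_quat_def by (simp add: power2_eq_square)

instantiation quat :: real_algebra_1
begin

definition "1 = Quat 1 0 0 0"
definition "x * y = Quat
  (qRe x * qRe y - qI x * qI y - qJ x * qJ y - qK x * qK y)
  (qRe x * qI y + qI x * qRe y + qJ x * qK y - qK x * qJ y)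
  (qRe x * qJ y - qI x * qK y + qJ x * qRe y + qK x * qI y)
  (qRe x * qK y + qI x * qJ y - qJ x * qI y + qK x * qRe y)"

instance
  by standard (simp_all add: quat_eq_iff one_quat_def times_quat_def algebra_simps)

end

definition quat_cnj :: "quat \<Rightarrow> quat" where
  "quat_cnj x = Quat (qRe x) (- qI x) (- qJ x) (- qK x)"

lemma quat_mult_cnj:
  "x * quat_cnj x = (norm x)\<^sup>2 *\<^sub>R 1" "quat_cnj x * x = (norm x)\<^sup>2 *\<^sub>R 1"
  unfolding norm_quat_squared
  by (simp_all add: quat_eq_iff quat_cnj_def times_quat_def one_quat_def power2_eq_square)

instantiation quat :: real_normed_div_algebra
begin

definition "inverse x = quat_cnj x /\<^sub>R (norm x)\<^sup>2"
definition "x div (y :: quat) = x * inverse y"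

instance
proof
  fix x y :: quat
  show "x \<noteq> 0 \<Longrightarrow> inverse x * x = 1" "x \<noteq> 0 \<Longrightarrow> x * inverse x = 1"
    by (simp_all add: inverse_quat_def quat_mult_cnj)
  show "x div y = x * inverse y"
    by (fact divide_quat_def)
  show "inverse (0 :: quat) = 0"
    by (simp add: inverse_quat_def quat_cnj_def quat_eq_iff)
  have "(norm (x * y))\<^sup>2 = (norm x * norm y)\<^sup>2"
    unfolding power_mult_distrib norm_quat_squared
    by (simp add: times_quat_def) algebra
  then show "norm (x * y) = norm x * norm y"
    by (simp add: power2_eq_iff_nonneg)
qed

end

instantiation quat :: euclidean_space
begin

definition "Basis = {Quat 1 0 0 0, Quat 0 1 0 0, Quat 0 0 1 0, Quat 0 0 0 1}"

instance
proof
  show "(Basis :: quat set) \<noteq> {}" "finite (Basis :: quat set)"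
    by (simp_all add: Basis_quat_def)
  show "inner u v = (if u = v then 1 else 0)" if "u \<in> Basis" "v \<in> Basis" for u v :: quat
    using that unfolding Basis_quat_def by (elim insertE emptyE; simp add: inner_quat_def)
  show "(\<forall>u\<in>Basis. inner x u = 0) \<longleftrightarrow> x = 0" for x :: quat
    unfolding Basis_quat_def ball_simps by (simp add: inner_quat_def) (simp add: quat_eq_iff)
qed

end


section \<open>Quaternionic intersections of quadrics\<close>

text \<open>
  The index set \<open>[n]\<close> is a finite type \<open>'n\<close>; points of \<open>\<real>\<^sup>n\<close> and \<open>\<H>\<^sup>n\<close> are
  functions on \<open>'n\<close>, the latter carrying the product topology of
  \<^theory>\<open>HOL-Analysis.Function_Topology\<close>.
\<close>

definition admissible :: "('n::finite \<Rightarrow> real ^ 'd) \<Rightarrow> bool" where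
  "admissible lam \<longleftrightarrow>
     0 \<in> convex hull (range lam) \<and>
     (\<forall>I. 0 \<in> convex hull (lam ` I) \<longrightarrow> card I > CARD('d))"

definition ZH :: "('n::finite \<Rightarrow> real ^ 'd) \<Rightarrow> ('n \<Rightarrow> quat) set" where
  "ZH lam = {q. (\<Sum>i\<in>UNIV. (norm (q i))\<^sup>2 *\<^sub>R lam i) = 0 \<and> (\<Sum>i\<in>UNIV. (norm (q i))\<^sup>2) = 1}"

definition assoc_polytope :: "('n::finite \<Rightarrow> real ^ 'd) \<Rightarrow> ('n \<Rightarrow> real) set" where
  "assoc_polytope lam =
     {x. (\<forall>i. x i \<ge> 0) \<and> (\<Sum>i\<in>UNIV. x i *\<^sub>R lam i) = 0 \<and> (\<Sum>i\<in>UNIV. x i) = 1}"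

definition indispensable :: "('n::finite \<Rightarrow> real ^ 'd) \<Rightarrow> 'n \<Rightarrow> bool" where
  "indispensable lam i \<longleftrightarrow> (\<forall>x\<in>assoc_polytope lam. x i > 0)"

definition face_complex :: "('n \<Rightarrow> real) set \<Rightarrow> 'n set set" where
  "face_complex P = {J. P \<inter> {x. \<forall>j\<in>J. x j = 0} \<noteq> {}}"

definition ghost_vertex :: "'n set set \<Rightarrow> 'n \<Rightarrow> bool" where
  "ghost_vertex K i \<longleftrightarrow> {i} \<notin> K"

text \<open>
  The vertex set \<open>V\<close> is explicit so that the product may also be formed over a part of \<open>[n]\<close>.
  For \<open>V = UNIV\<close> the extensional product \<open>Pi\<^sub>E\<close> is the plain Cartesian product.
\<close>

definition polyhedral_product :: "'n set \<Rightarrow> 'a set \<Rightarrow> 'a set \<Rightarrow> 'n set set \<Rightarrow> ('n \<Rightarrow> 'a) set" where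
  "polyhedral_product V X A K = (\<Union>\<sigma>\<in>K. \<Pi>\<^sub>E i\<in>V. if i \<in> \<sigma> then X else A)"

definition Sp1 :: "quat set" where
  "Sp1 = {u. norm u = 1}"

definition right_mult :: "('n \<Rightarrow> quat) \<Rightarrow> ('n \<Rightarrow> quat) \<Rightarrow> ('n \<Rightarrow> quat)" where
  "right_mult q u = (\<lambda>i. q i * u i)"

text \<open>Both sides of the homeomorphism are stable under the action.\<close>

lemma right_mult_ZH:
  assumes "q \<in> ZH lam" and "\<forall>i. u i \<in> Sp1"
  shows "right_mult q u \<in> ZH lam"
  using assms by (simp add: ZH_def Sp1_def right_mult_def norm_mult)

lemma right_mult_polyhedral_product:
  assumes "q \<in> polyhedral_product UNIV (cball 0 1) (sphere 0 1) K" and "\<forall>i. u i \<in> Sp1"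
  shows "right_mult q u \<in> polyhedral_product UNIV (cball 0 1) (sphere 0 1) K"
proof -
  obtain \<sigma> where "\<sigma> \<in> K" and *: "\<And>i. q i \<in> (if i \<in> \<sigma> then cball 0 1 else sphere 0 1)"
    using assms(1) unfolding polyhedral_product_def by (blast dest: PiE_mem)
  have "right_mult q u i \<in> (if i \<in> \<sigma> then cball 0 1 else sphere 0 1)" for i
  proof -
    have "norm (right_mult q u i) = norm (q i)"
      using assms(2) by (simp add: Sp1_def right_mult_def norm_mult)
    with *[of i] show ?thesis
      by (cases "i \<in> \<sigma>") simp_all
  qed
  then have "right_mult q u \<in> (\<Pi>\<^sub>E i\<in>UNIV. if i \<in> \<sigma> then cball 0 1 else sphere 0 1)"
    by (simp only: PiE_UNIV_domain Pi_iff) blast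
  with \<open>\<sigma> \<in> K\<close> show ?thesis
    unfolding polyhedral_product_def by blast
qed

end

theory Submission
  imports Defs
begin

text \<open>
  Let the group \<open>\<real>\<^sup>d \<times> \<real>\<close> act on \<open>\<H>\<^sup>n\<close> by multiplying the \<open>i\<close>-th coordinate with
  \<open>exp (c + v \<bullet> lam i)\<close>. Both spaces are slices of this action: every orbit that meets one of them
  meets each of them in exactly one point. The point in \<open>ZH lam\<close> is found by minimising
  \<open>\<Sum>\<^sub>i |q\<^sub>i|\<^sup>2 exp (v \<bullet> lam i)\<close> over \<open>v\<close>, the point in the polyhedral product by minimising
  \<open>max\<^sub>i |q\<^sub>i| exp (v \<bullet> lam i)\<close>; there the indices attaining the maximum support a point of the
  polytope. The pairs \<open>(q, p)\<close> for which \<open>q\<close> lies in \<open>ZH lam\<close> and its translate by \<open>p\<close> in the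
  polyhedral product form a compact set, and it projects bijectively onto either space. The
  resulting homeomorphism is equivariant because the scaling factors are real.
\<close>

section \<open>The scaling action and its weights\<close>

text \<open>The logarithm of the factor applied to coordinate \<open>i\<close>. Its linearity in
  \<open>p\<close> makes \<open>rescale\<close> an additive group action.\<close>

definition weight :: "('n \<Rightarrow> real ^ 'd) \<Rightarrow> (real ^ 'd) \<times> real \<Rightarrow> 'n \<Rightarrow> real" where
  "weight lam p i = snd p + fst p \<bullet> lam i"

definition rescale :: "('n \<Rightarrow> real ^ 'd) \<Rightarrow> (real ^ 'd) \<times> real \<Rightarrow> ('n \<Rightarrow> quat) \<Rightarrow> 'n \<Rightarrow> quat" where
  "rescale lam p q = (\<lambda>i. exp (weight lam p i) *\<^sub>R q i)"

lemma weight_simps [simp]: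
  "weight lam 0 i = 0"
  "weight lam (p + p') i = weight lam p i + weight lam p' i"
  "weight lam (- p) i = - weight lam p i"
  "weight lam (p - p') i = weight lam p i - weight lam p' i"
  "weight lam (r *\<^sub>R p) i = r * weight lam p i"
  by (simp_all add: weight_def inner_left_distrib inner_diff_left distrib_left)

lemma continuous_on_weight [continuous_intros]:
  "continuous_on S f \<Longrightarrow> continuous_on S (\<lambda>x. weight lam (f x) i)"
  unfolding weight_def by (intro continuous_intros)

lemma norm_rescale [simp]: "norm (rescale lam p q i) = exp (weight lam p i) * norm (q i)"
  by (simp add: rescale_def)

lemma rescale_add: "rescale lam p (rescale lam p' q) = rescale lam (p + p') q"
  by (simp add: rescale_def exp_add)

lemma rescale_0 [simp]: "rescale lam 0 q = q"
  by (simp add: rescale_def)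

lemma rescale_right_mult: "rescale lam p (right_mult q u) = right_mult (rescale lam p q) u"
  by (simp add: rescale_def right_mult_def)

section \<open>Weights averaged over points of the polytope\<close>

text \<open>The \<open>fst p\<close> part averages to zero by the linear relation defining the
  polytope. This lets signs of weights control \<open>snd p\<close>.\<close>

lemma sum_weight_assoc_polytope:
  fixes lam :: "'n::finite \<Rightarrow> real ^ 'd"
  assumes "x \<in> assoc_polytope lam"
  shows "(\<Sum>i\<in>UNIV. x i * weight lam p i) = snd p"
proof -
  have "(\<Sum>i\<in>UNIV. x i * weight lam p i)
      = snd p * (\<Sum>i\<in>UNIV. x i) + fst p \<bullet> (\<Sum>i\<in>UNIV. x i *\<^sub>R lam i)"
    by (simp add: weight_def algebra_simps sum.distrib inner_sum_right sum_distrib_left)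
  with assms show ?thesis
    by (simp add: assoc_polytope_def)
qed

lemma assoc_polytope_support:
  fixes lam :: "'n::finite \<Rightarrow> real ^ 'd"
  assumes "x \<in> assoc_polytope lam"
  shows "0 \<in> convex hull (lam ` {i. x i \<noteq> 0})"
proof -
  have "(\<Sum>i\<in>{i. x i \<noteq> 0}. x i *\<^sub>R lam i) = (\<Sum>i\<in>UNIV. x i *\<^sub>R lam i)"
    by (rule sum.mono_neutral_left) auto
  moreover have "(\<Sum>i\<in>{i. x i \<noteq> 0}. x i) = (\<Sum>i\<in>UNIV. x i)"
    by (rule sum.mono_neutral_left) auto
  moreover have "(\<Sum>i\<in>{i. x i \<noteq> 0}. x i *\<^sub>R lam i) \<in> convex hull (lam ` {i. x i \<noteq> 0})"
    if "(\<Sum>i\<in>{i. x i \<noteq> 0}. x i) = 1"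
    using that assms by (intro convex_sum) (auto simp: assoc_polytope_def hull_inc)
  ultimately show ?thesis
    using assms by (simp add: assoc_polytope_def)
qed

lemma assoc_polytope_if_convex_hull:
  fixes lam :: "'n::finite \<Rightarrow> real ^ 'd"
  assumes "0 \<in> convex hull (lam ` I)"
  obtains x where "x \<in> assoc_polytope lam" "\<And>i. i \<notin> I \<Longrightarrow> x i = 0"
proof -
  \<comment> \<open>Since \<open>lam\<close> may repeat vectors, one index per vector is chosen, so
    that coefficients on points become coefficients on indices without double counting.\<close>
  obtain I' where I': "I' \<subseteq> I" "inj_on lam I'" "lam ` I = lam ` I'"
    by (metis subset_image_inj subset_refl)
  from assms obtain u where u: "\<forall>y\<in>lam ` I'. 0 \<le> u y" "sum u (lam ` I') = 1"
      "(\<Sum>y\<in>lam ` I'. u y *\<^sub>R y) = 0"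
    unfolding I'(3) by (auto simp: convex_hull_finite)
  let ?x = "\<lambda>i. if i \<in> I' then u (lam i) else 0"
  have "(\<Sum>i\<in>UNIV. ?x i *\<^sub>R lam i) = (\<Sum>i\<in>I'. u (lam i) *\<^sub>R lam i)"
    by (rule sum.mono_neutral_cong_right) auto
  moreover have "(\<Sum>i\<in>UNIV. ?x i) = (\<Sum>i\<in>I'. u (lam i))"
    by (rule sum.mono_neutral_cong_right) auto
  ultimately have "?x \<in> assoc_polytope lam"
    using u I'(2) by (auto simp: assoc_polytope_def sum.reindex)
  then show thesis
    by (rule that) (use I'(1) in auto)
qed

text \<open>This is the only place where admissibility is used: by Caratheodory's theorem, a support on
  which \<open>v \<bullet> lam i\<close> vanishes for some \<open>v \<noteq> 0\<close> could be thinned out to at most \<open>d\<close> indices.\<close>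

lemma weight_eq_0D:
  fixes lam :: "'n::finite \<Rightarrow> real ^ 'd"
  assumes adm: "admissible lam" and x: "x \<in> assoc_polytope lam"
    and w: "\<And>i. x i \<noteq> 0 \<Longrightarrow> weight lam p i = 0"
  shows "p = 0"
proof -
  have snd: "snd p = 0"
    using sum_weight_assoc_polytope[OF x, of p] w
    by (metis (no_types, lifting) mult_eq_0_iff sum.neutral)
  let ?I = "{i. x i \<noteq> 0}"
  have "fst p = 0"
  proof (rule ccontr)
    assume "fst p \<noteq> 0"
    have "lam ` ?I \<subseteq> {y. fst p \<bullet> y = 0}"
      using w snd by (auto simp: weight_def)
    then have "aff_dim (lam ` ?I) \<le> aff_dim {y. fst p \<bullet> y = 0}"
      by (rule aff_dim_subset)
    also have "\<dots> = int (CARD('d)) - 1"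
      using \<open>fst p \<noteq> 0\<close> by simp
    finally have dim: "aff_dim (lam ` ?I) + 1 \<le> int CARD('d)" by simp
    obtain S where S: "S \<subseteq> lam ` ?I" "int (card S) \<le> aff_dim (lam ` ?I) + 1" "0 \<in> convex hull S"
      using equalityD1[OF caratheodory_aff_dim, THEN subsetD, OF assoc_polytope_support[OF x]]
      by (auto simp only: mem_Collect_eq)
    \<comment> \<open>Admissibility counts indices, Caratheodory's theorem counts points; one index
      per point makes the two counts agree.\<close>
    obtain J where J: "inj_on lam J" "S = lam ` J"
      using S(1) by (metis subset_image_inj)
    have "card J > CARD('d)"
      using adm S(3) J(2) unfolding admissible_def by blast
    moreover have "card J = card S"
      using J by (simp add: card_image)
    ultimately show False using S(2) dim by linarith
  qed
  with snd show ?thesis by (simp add: prod_eq_iff)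
qed

text \<open>The average of the weights against \<open>x\<close> is \<open>snd p \<le> 0\<close>, yet
  no term is negative. So all terms vanish, and \<open>weight_eq_0D\<close> applies.\<close>

lemma weight_nonneg_imp_0:
  fixes lam :: "'n::finite \<Rightarrow> real ^ 'd"
  assumes adm: "admissible lam" and x: "x \<in> assoc_polytope lam"
    and w: "\<And>i. x i \<noteq> 0 \<Longrightarrow> weight lam p i \<ge> 0" and "snd p \<le> 0"
  shows "p = 0"
proof -
  have nn: "x i * weight lam p i \<ge> 0" for i
    using w[of i] x by (cases "x i = 0") (auto simp: assoc_polytope_def)
  then have "(\<Sum>i\<in>UNIV. x i * weight lam p i) = 0"
    using sum_weight_assoc_polytope[OF x, of p] sum_nonneg[of UNIV "\<lambda>i. x i * weight lam p i"]
      \<open>snd p \<le> 0\<close> by simp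
  then have "x i * weight lam p i = 0" for i
    using nn by (subst (asm) sum_nonneg_eq_0_iff) auto
  then show ?thesis
    by (intro weight_eq_0D[OF adm x]) auto
qed

section \<open>Membership criteria and compactness of both spaces\<close>

lemma ZH_imp_assoc_polytope: "q \<in> ZH lam \<Longrightarrow> (\<lambda>i. (norm (q i))\<^sup>2) \<in> assoc_polytope lam"
  by (simp add: ZH_def assoc_polytope_def)

text \<open>Any face that admits \<open>q\<close> contains
  \<open>{i. norm (q i) \<noteq> 1}\<close>, and a polytope point vanishing on the larger face
  vanishes on this set too. The union over faces thus becomes the existence of one witness
  \<open>x\<close>.\<close>

lemma mem_moment_angle_iff:
  fixes lam :: "'n::finite \<Rightarrow> real ^ 'd" and q :: "'n \<Rightarrow> quat"
  shows "q \<in> polyhedral_product UNIV (cball 0 1) (sphere 0 1) (face_complex (assoc_polytope lam))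
    \<longleftrightarrow> (\<forall>i. norm (q i) \<le> 1) \<and> (\<exists>x\<in>assoc_polytope lam. \<forall>i. norm (q i) \<noteq> 1 \<longrightarrow> x i = 0)"
    (is "?L \<longleftrightarrow> ?R")
proof
  assume ?L
  then obtain \<sigma> where \<sigma>: "\<sigma> \<in> face_complex (assoc_polytope lam)"
      and q: "\<And>i. q i \<in> (if i \<in> \<sigma> then cball 0 1 else sphere 0 1)"
    unfolding polyhedral_product_def by (blast dest: PiE_mem)
  from \<sigma> obtain x where x: "x \<in> assoc_polytope lam" "\<forall>j\<in>\<sigma>. x j = 0"
    by (auto simp: face_complex_def)
  have "norm (q i) \<le> 1" "norm (q i) \<noteq> 1 \<longrightarrow> i \<in> \<sigma>" for i
    using q[of i] by (auto split: if_splits)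
  with x show ?R by blast
next
  assume R: ?R
  then obtain x where x: "x \<in> assoc_polytope lam" "\<forall>i. norm (q i) \<noteq> 1 \<longrightarrow> x i = 0"
    by blast
  then have "{i. norm (q i) \<noteq> 1} \<in> face_complex (assoc_polytope lam)"
    by (auto simp: face_complex_def)
  with R show ?L
    unfolding polyhedral_product_def by (intro UN_I) (auto simp: PiE_UNIV_domain)
qed

lemma compact_fun_box:
  fixes C :: "'n \<Rightarrow> 'a::topological_space set"
  assumes "\<And>i. compact (C i)"
  shows "compact {f. \<forall>i. f i \<in> C i}"
proof -
  have "compactin (product_topology (\<lambda>i. euclidean) UNIV) (PiE UNIV C)"
    using assms by (subst compactin_PiE) auto
  then have "compact (PiE UNIV C)"
    by (simp add: euclidean_product_topology)
  then show ?thesis by (simp add: PiE_UNIV_domain Pi_def)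
qed

lemma norm_le_1_if_ZH:
  fixes lam :: "'n::finite \<Rightarrow> real ^ 'd"
  assumes "q \<in> ZH lam"
  shows "norm (q i) \<le> 1"
proof -
  have "(norm (q i))\<^sup>2 \<le> (\<Sum>i\<in>UNIV. (norm (q i))\<^sup>2)"
    by (rule member_le_sum) auto
  with assms show ?thesis
    by (simp add: ZH_def abs_square_le_1)
qed

lemma compact_ZH:
  fixes lam :: "'n::finite \<Rightarrow> real ^ 'd"
  shows "compact (ZH lam)"
proof -
  have "ZH lam = {q. \<forall>i. q i \<in> cball 0 1} \<inter> ZH lam"
    by (auto simp: norm_le_1_if_ZH)
  moreover have "closed (ZH lam)"
    unfolding ZH_def
    by (intro closed_Collect_conj closed_Collect_eq continuous_intros continuous_on_product_coordinates)
  moreover have "compact {q :: 'n \<Rightarrow> quat. \<forall>i. q i \<in> cball 0 1}"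
    by (rule compact_fun_box) simp
  ultimately show ?thesis
    by (metis compact_Int_closed)
qed

lemma compact_polyhedral_product:
  fixes K :: "'n::finite set set" and X A :: "'a::topological_space set"
  assumes "compact X" "compact A"
  shows "compact (polyhedral_product UNIV X A K)"
proof -
  have "compact {f. \<forall>i. f i \<in> (if i \<in> \<sigma> then X else A)}" for \<sigma> :: "'n set"
    using assms by (intro compact_fun_box) auto
  then show ?thesis
    unfolding polyhedral_product_def PiE_UNIV_domain Pi_def
    by (intro compact_UN) auto
qed

section \<open>Existence of representatives by minimisation\<close>

lemma continuous_on_Max_image:
  fixes f :: "'i \<Rightarrow> 'a::topological_space \<Rightarrow> 'b::linorder_topology"
  assumes "finite I" "I \<noteq> {}" "\<And>i. i \<in> I \<Longrightarrow> continuous_on S (f i)"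
  shows "continuous_on S (\<lambda>x. Max ((\<lambda>i. f i x) ` I))"
  using assms by (induction rule: finite_ne_induct) (auto intro: continuous_on_max)

lemma self_le_exp: "x \<le> exp (x :: real)"
  using exp_ge_add_one_self[of x] by linarith

text \<open>Coercivity: the \<open>a i\<close> are positive on the support of a polytope point, so
  in each direction \<open>v \<noteq> 0\<close> some exponential below \<open>F\<close> grows.
  Keeping \<open>F\<close> abstract covers both the sum and the maximum.\<close>

lemma exponential_attains_min:
  fixes lam :: "'n::finite \<Rightarrow> real ^ 'd" and F :: "real ^ 'd \<Rightarrow> real"
  assumes adm: "admissible lam" and x: "x \<in> assoc_polytope lam"
    and a: "\<And>i. a i \<ge> 0" "\<And>i. a i = 0 \<Longrightarrow> x i = 0"
    and F: "continuous_on UNIV F" "\<And>v i. a i * exp (v \<bullet> lam i) \<le> F v"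
  obtains v where "\<And>v'. F v \<le> F v'"
proof -
  \<comment> \<open>Positively homogeneous in \<open>v\<close> and, since
    \<open>max 0 t \<le> exp t\<close>, a lower bound for \<open>F\<close> up to the factor
    \<open>CARD('n)\<close>.\<close>
  define \<phi> where "\<phi> v = (\<Sum>i\<in>UNIV. a i * max 0 (v \<bullet> lam i))" for v
  have \<phi>_pos: "\<phi> v > 0" if "v \<noteq> 0" for v
  proof (rule ccontr)
    assume "\<not> \<phi> v > 0"
    moreover have nn: "a i * max 0 (v \<bullet> lam i) \<ge> 0" for i
      using a(1) by simp
    ultimately have "\<phi> v = 0"
      using sum_nonneg[of UNIV "\<lambda>i. a i * max 0 (v \<bullet> lam i)"] unfolding \<phi>_def by force
    then have zero: "a i * max 0 (v \<bullet> lam i) = 0" for i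
      using nn unfolding \<phi>_def by (subst (asm) sum_nonneg_eq_0_iff) auto
    \<comment> \<open>If \<open>\<phi> v = 0\<close>, then \<open>v \<bullet> lam i \<le> 0\<close>
      on the support of \<open>x\<close>, so the opposite direction has nonnegative weights
      there.\<close>
    have "weight lam (- v, 0) i \<ge> 0" if "x i \<noteq> 0" for i
      using zero[of i] a(2)[of i] that by (auto simp: weight_def max_def split: if_splits)
    then have "(- v, 0) = (0 :: (real ^ 'd) \<times> real)"
      by (intro weight_nonneg_imp_0[OF adm x]) auto
    with that show False by (simp add: zero_prod_def)
  qed
  have \<phi>_cont: "continuous_on S \<phi>" for S
    unfolding \<phi>_def by (intro continuous_intros)
  \<comment> \<open>The minimum of \<open>\<phi>\<close> on the unit sphere is positive, and
    homogeneity spreads it to all \<open>v\<close> as linear growth.\<close>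
  have "\<exists>\<epsilon>>0. \<forall>v. \<epsilon> * norm v \<le> \<phi> v"
  proof -
    obtain v0 :: "real ^ 'd" where v0: "v0 \<in> sphere 0 1" "\<And>v. v \<in> sphere 0 1 \<Longrightarrow> \<phi> v0 \<le> \<phi> v"
      using continuous_attains_inf[of "sphere (0 :: real ^ 'd) 1" \<phi>] \<phi>_cont by auto
    have "\<phi> v0 * norm v \<le> \<phi> v" for v
    proof (cases "v = 0")
      case False
      have "\<phi> v0 * norm v \<le> \<phi> (v /\<^sub>R norm v) * norm v"
        using False by (intro mult_right_mono v0(2)) auto
      also have "\<dots> = \<phi> v"
        using False unfolding \<phi>_def sum_distrib_right
        by (intro sum.cong) (auto simp: max_def field_simps)
      finally show ?thesis .
    qed (simp add: \<phi>_def)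
    moreover have "\<phi> v0 > 0" using v0(1) by (intro \<phi>_pos) auto
    ultimately show ?thesis by blast
  qed
  then obtain \<epsilon> where \<epsilon>: "\<epsilon> > 0" "\<And>v. \<epsilon> * norm v \<le> \<phi> v" by blast
  have \<phi>_le: "\<phi> v \<le> CARD('n) * F v" for v
  proof -
    have "a i * max 0 (v \<bullet> lam i) \<le> F v" for i
    proof -
      have "max 0 (v \<bullet> lam i) \<le> exp (v \<bullet> lam i)"
        using self_le_exp by simp
      then have "a i * max 0 (v \<bullet> lam i) \<le> a i * exp (v \<bullet> lam i)"
        using a(1) by (rule mult_left_mono)
      also have "\<dots> \<le> F v" by (rule F(2))
      finally show ?thesis .
    qed
    then show ?thesis
      unfolding \<phi>_def by (intro sum_bounded_above)
  qed
  \<comment> \<open>Linear growth bounds this sublevel set, hence it is compact; a minimum on it is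
    global because \<open>F\<close> exceeds \<open>F 0\<close> outside.\<close>
  let ?L = "{v. F v \<le> F 0}"
  have "closed ?L"
    using F(1) by (intro closed_Collect_le) auto
  moreover have "?L \<subseteq> cball 0 (CARD('n) * F 0 / \<epsilon>)"
  proof
    fix v assume "v \<in> ?L"
    then have "CARD('n) * F v \<le> CARD('n) * F 0"
      by (intro mult_left_mono) auto
    then have "\<epsilon> * norm v \<le> CARD('n) * F 0"
      using \<epsilon>(2)[of v] \<phi>_le[of v] by linarith
    then show "v \<in> cball 0 (CARD('n) * F 0 / \<epsilon>)"
      using \<epsilon>(1) by (simp add: field_simps)
  qed
  ultimately have "compact ?L"
    using bounded_subset[OF bounded_cball] compact_eq_bounded_closed by blast
  then obtain v where v: "v \<in> ?L" "\<And>v'. v' \<in> ?L \<Longrightarrow> F v \<le> F v'"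
    using continuous_attains_inf[of ?L F] continuous_on_subset[OF F(1), of ?L] by blast
  have "F v \<le> F v'" for v'
    using v(1) v(2)[of v'] by (cases "v' \<in> ?L") auto
  then show thesis using that by blast
qed

text \<open>At a minimiser of \<open>G\<close> the vanishing gradient is the quadric equation; the
  scalar part of \<open>p\<close> then arranges the unit sum.\<close>

lemma rescale_into_ZH:
  fixes lam :: "'n::finite \<Rightarrow> real ^ 'd"
  assumes adm: "admissible lam" and x: "x \<in> assoc_polytope lam"
    and w: "\<And>i. w i = 0 \<Longrightarrow> x i = 0"
  obtains p where "rescale lam p w \<in> ZH lam"
proof -
  define e where "e v i = (norm (w i))\<^sup>2 * exp (v \<bullet> lam i)" for v i
  define G where "G v = (\<Sum>i\<in>UNIV. e v i)" for v
  have e_nn: "e v i \<ge> 0" for v i by (simp add: e_def)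
  obtain v where v: "\<And>v'. G v \<le> G v'"
  proof (rule exponential_attains_min[OF adm x, of "\<lambda>i. (norm (w i))\<^sup>2" G])
    show "continuous_on UNIV G"
      unfolding G_def e_def by (intro continuous_intros)
    show "(norm (w i))\<^sup>2 * exp (v \<bullet> lam i) \<le> G v" for v i
      using member_le_sum[of i UNIV "e v"] e_nn by (simp add: G_def e_def)
  qed (use w in auto)
  \<comment> \<open>The gradient of \<open>G\<close> at \<open>v\<close>. The derivative along
    \<open>u\<close> itself is \<open>u \<bullet> u\<close>, which must vanish at a minimum.\<close>
  define u where "u = (\<Sum>i\<in>UNIV. e v i *\<^sub>R lam i)"
  have deriv: "((\<lambda>t. G (v + t *\<^sub>R u)) has_real_derivative (\<Sum>i\<in>UNIV. e v i * (u \<bullet> lam i))) (at 0)"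
    unfolding G_def e_def inner_add_left inner_scaleR_left
    by (rule DERIV_sum) (auto intro!: derivative_eq_intros)
  have "(\<Sum>i\<in>UNIV. e v i * (u \<bullet> lam i)) = 0"
    by (rule DERIV_local_min[OF deriv zero_less_one]) (simp add: v)
  then have "u \<bullet> u = 0"
    unfolding u_def by (simp add: inner_sum_right)
  then have u0: "(\<Sum>i\<in>UNIV. e v i *\<^sub>R lam i) = 0"
    by (simp add: u_def)
  \<comment> \<open>The support of \<open>x\<close> is nonempty, so some \<open>w i\<close> is
    nonzero and \<open>ln (G v)\<close> makes sense.\<close>
  have "(\<Sum>i\<in>UNIV. x i) = 1" using x by (simp add: assoc_polytope_def)
  then obtain i where "x i \<noteq> 0"
    by (metis sum.neutral zero_neq_one)
  with w have "w i \<noteq> 0" by blast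
  then have "e v i > 0" by (simp add: e_def)
  then have G_pos: "G v > 0"
    unfolding G_def using e_nn by (intro sum_pos2[of UNIV i]) auto
  \<comment> \<open>Both components are halved because squaring the norm doubles the
    exponent.\<close>
  define p where "p = (v /\<^sub>R 2, - ln (G v) / 2)"
  have "(norm (rescale lam p w i))\<^sup>2 = e v i / G v" for i
  proof -
    have "(exp (weight lam p i))\<^sup>2 = exp (v \<bullet> lam i - ln (G v))"
      by (simp add: p_def weight_def flip: exp_double)
    also have "\<dots> = exp (v \<bullet> lam i) / G v"
      using G_pos by (simp add: exp_diff)
    finally show ?thesis
      by (simp add: power_mult_distrib e_def)
  qed
  moreover have "(\<Sum>i\<in>UNIV. (e v i / G v) *\<^sub>R lam i) = (\<Sum>i\<in>UNIV. e v i *\<^sub>R lam i) /\<^sub>R G v"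
    by (simp add: scaleR_sum_right divide_inverse mult.commute)
  moreover have "(\<Sum>i\<in>UNIV. e v i / G v) = 1"
    using G_pos by (simp add: G_def flip: sum_divide_distrib)
  ultimately have "rescale lam p w \<in> ZH lam"
    unfolding ZH_def using u0 by simp
  then show thesis by (rule that)
qed

text \<open>At a minimiser of \<open>F\<close> the vectors of the maximal indices have zero in their
  convex hull. The resulting polytope point vanishes at all other indices, which is the witness
  asked for by \<open>mem_moment_angle_iff\<close>.\<close>

lemma rescale_into_polyhedral_product:
  fixes lam :: "'n::finite \<Rightarrow> real ^ 'd"
  assumes adm: "admissible lam" and x: "x \<in> assoc_polytope lam"
    and q: "\<And>i. q i = 0 \<Longrightarrow> x i = 0"
  obtains p where "rescale lam p q
    \<in> polyhedral_product UNIV (cball 0 1) (sphere 0 1) (face_complex (assoc_polytope lam))"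
proof -
  define e where "e v i = norm (q i) * exp (v \<bullet> lam i)" for v i
  define F where "F v = Max (range (e v))" for v
  have e_le: "e v i \<le> F v" for v i by (simp add: F_def)
  obtain v where v: "\<And>v'. F v \<le> F v'"
  proof (rule exponential_attains_min[OF adm x, of "\<lambda>i. norm (q i)" F])
    show "continuous_on UNIV F"
      unfolding F_def e_def by (intro continuous_on_Max_image continuous_intros) auto
    show "norm (q i) * exp (v \<bullet> lam i) \<le> F v" for v i
      using e_le[of v i] by (simp add: e_def)
  qed (use q in auto)
  have "(\<Sum>i\<in>UNIV. x i) = 1" using x by (simp add: assoc_polytope_def)
  then obtain i where "x i \<noteq> 0"
    by (metis sum.neutral zero_neq_one)
  with q have "q i \<noteq> 0" by blast
  then have "e v i > 0" by (simp add: e_def)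
  then have F_pos: "F v > 0" using e_le[of v i] by simp
  \<comment> \<open>Otherwise moving \<open>v\<close> against a separating direction lowers the maximum.\<close>
  have "0 \<in> convex hull (lam ` {i. e v i = F v})"
  proof (rule ccontr)
    let ?I = "{i. e v i = F v}"
    assume "0 \<notin> convex hull (lam ` ?I)"
    moreover have "closed (convex hull (lam ` ?I))"
      by (intro compact_imp_closed finite_imp_compact_convex_hull) simp
    ultimately obtain u b where "b > 0" "\<forall>y\<in>convex hull (lam ` ?I). u \<bullet> y > b"
      using separating_hyperplane_closed_0[OF convex_convex_hull] by blast
    then have u: "u \<bullet> lam i > 0" if "e v i = F v" for i
      using that by (metis (mono_tags, lifting) hull_inc image_eqI less_trans mem_Collect_eq)
    have "\<forall>\<^sub>F t in at_right 0. e (v - t *\<^sub>R u) i < F v" for i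
    proof (cases "e v i = F v")
      case True
      have "e (v - t *\<^sub>R u) i < F v" if "t > 0" for t
      proof -
        have "norm (q i) > 0"
          using True F_pos by (auto simp: e_def)
        moreover have "exp ((v - t *\<^sub>R u) \<bullet> lam i) < exp (v \<bullet> lam i)"
          using u[OF True] that by (simp add: inner_diff_left)
        ultimately show ?thesis
          unfolding True[symmetric] by (simp add: e_def)
      qed
      then show ?thesis by (auto simp: eventually_at_filter)
    next
      case False
      with e_le have "e v i < F v" by (simp add: order.strict_iff_order)
      \<comment> \<open>An index strictly below the maximum stays below it for small
        \<open>t\<close> by continuity.\<close>
      moreover have "((\<lambda>t. e (v - t *\<^sub>R u) i) \<longlongrightarrow> e (v - 0 *\<^sub>R u) i) (at_right 0)"
        unfolding e_def by (intro tendsto_intros)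
      ultimately show ?thesis by (auto intro: order_tendstoD(2))
    qed
    then have "\<forall>\<^sub>F t in at_right (0 :: real). \<forall>i. e (v - t *\<^sub>R u) i < F v"
      by (simp add: eventually_all_finite)
    then obtain t :: real where "\<And>i. e (v - t *\<^sub>R u) i < F v"
      using eventually_happens' trivial_limit_at_right_real by (metis (mono_tags, lifting))
    then have "F (v - t *\<^sub>R u) < F v"
      by (simp add: F_def)
    with v show False by (meson not_less)
  qed
  then obtain y where y: "y \<in> assoc_polytope lam" "\<And>i. e v i \<noteq> F v \<Longrightarrow> y i = 0"
    by (rule assoc_polytope_if_convex_hull) auto
  \<comment> \<open>The scalar part divides by \<open>F v\<close>, so exactly the maximal indices
    get norm 1.\<close>
  define p where "p = (v, - ln (F v))"
  have norm_p: "norm (rescale lam p q i) = e v i / F v" for i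
    using F_pos by (simp add: p_def weight_def e_def exp_diff exp_minus field_simps)
  have "rescale lam p q
      \<in> polyhedral_product UNIV (cball 0 1) (sphere 0 1) (face_complex (assoc_polytope lam))"
    unfolding mem_moment_angle_iff norm_p
    using e_le F_pos y by (auto intro!: bexI[of _ y])
  then show thesis by (rule that)
qed

section \<open>Uniqueness of representatives\<close>

text \<open>The squared norms of \<open>q\<close> and of its translate are both polytope points, so
  the weights average to \<open>snd p\<close> against each. Their difference sums to zero, while
  each term has the sign of \<open>(exp (2 * t) - 1) * t \<ge> 0\<close>; so weights vanish where
  \<open>q i \<noteq> 0\<close>.\<close>

lemma rescale_ZH_imp_0:
  fixes lam :: "'n::finite \<Rightarrow> real ^ 'd"
  assumes adm: "admissible lam" and q: "q \<in> ZH lam" "rescale lam p q \<in> ZH lam"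
  shows "p = 0"
proof -
  let ?x = "\<lambda>i. (norm (q i))\<^sup>2" and ?y = "\<lambda>i. (norm (rescale lam p q i))\<^sup>2"
  have nn: "(?y i - ?x i) * weight lam p i \<ge> 0" for i
  proof -
    have "?y i - ?x i = ?x i * (exp (2 * weight lam p i) - 1)"
      by (simp add: exp_double algebra_simps)
    moreover have "(exp (2 * weight lam p i) - 1) * weight lam p i \<ge> 0"
      by (cases "weight lam p i \<ge> 0") (auto intro: mult_nonneg_nonneg mult_nonpos_nonpos)
    ultimately show ?thesis
      by (simp add: mult.assoc)
  qed
  have "(\<Sum>i\<in>UNIV. (?y i - ?x i) * weight lam p i) = 0"
    using sum_weight_assoc_polytope[OF ZH_imp_assoc_polytope[OF q(1)], of p]
      sum_weight_assoc_polytope[OF ZH_imp_assoc_polytope[OF q(2)], of p]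
    by (simp add: left_diff_distrib sum_subtractf del: norm_rescale)
  then have *: "(?y i - ?x i) * weight lam p i = 0" for i
    using nn by (subst (asm) sum_nonneg_eq_0_iff) auto
  have "weight lam p i = 0" if "?x i \<noteq> 0" for i
  proof (rule ccontr)
    assume "weight lam p i \<noteq> 0"
    with *[of i] have "(exp (weight lam p i))\<^sup>2 * ?x i = 1 * ?x i"
      by (simp add: power_mult_distrib)
    with that have "exp (2 * weight lam p i) = 1"
      unfolding mult_cancel_right exp_double by blast
    with \<open>weight lam p i \<noteq> 0\<close> show False by simp
  qed
  then show ?thesis
    by (rule weight_eq_0D[OF adm ZH_imp_assoc_polytope[OF q(1)]])
qed

text \<open>Where \<open>w\<close> has norm 1 the weight cannot be positive; averaging against the
  witness of \<open>w\<close> gives \<open>snd p \<le> 0\<close>. Where the translate has norm 1 the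
  weight cannot be negative, so its witness \<open>y\<close> fits
  \<open>weight_nonneg_imp_0\<close>.\<close>

lemma rescale_polyhedral_product_imp_0:
  fixes lam :: "'n::finite \<Rightarrow> real ^ 'd"
  defines "W \<equiv> polyhedral_product UNIV (cball 0 1) (sphere 0 1) (face_complex (assoc_polytope lam))"
  assumes adm: "admissible lam" and w: "w \<in> W" "rescale lam p w \<in> W"
  shows "p = 0"
proof -
  have le: "norm (w i) \<le> 1" "exp (weight lam p i) * norm (w i) \<le> 1" for i
    using w by (auto simp: W_def mem_moment_angle_iff)
  obtain x where x: "x \<in> assoc_polytope lam" "\<And>i. norm (w i) \<noteq> 1 \<Longrightarrow> x i = 0"
    using w(1) unfolding W_def mem_moment_angle_iff by blast
  obtain y where y: "y \<in> assoc_polytope lam" "\<And>i. exp (weight lam p i) * norm (w i) \<noteq> 1 \<Longrightarrow> y i = 0"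
    using w(2) unfolding W_def mem_moment_angle_iff norm_rescale by blast
  have "x i * weight lam p i \<le> 0" for i
    using le(2)[of i] x(1) x(2)[of i]
    by (cases "norm (w i) = 1") (auto simp: assoc_polytope_def mult_nonneg_nonpos)
  then have "snd p \<le> 0"
    unfolding sum_weight_assoc_polytope[OF x(1), of p, symmetric] by (intro sum_nonpos)
  moreover have "weight lam p i \<ge> 0" if "y i \<noteq> 0" for i
  proof (rule ccontr)
    assume "\<not> weight lam p i \<ge> 0"
    then have "exp (weight lam p i) * norm (w i) < 1"
      using le(1)[of i] mult_left_le[of "norm (w i)" "exp (weight lam p i)"]
      by (smt (verit) exp_gt_zero exp_less_one_iff)
    with y(2)[of i] that show False by auto
  qed
  ultimately show ?thesis
    by (intro weight_nonneg_imp_0[OF adm y(1)])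
qed

section \<open>Boundedness of the translating parameters\<close>

text \<open>Supplies the bound on \<open>p\<close> that makes the set of pairs \<open>(q, p)\<close>
  compact.\<close>

lemma bounded_rescale_ZH_polyhedral_product:
  fixes lam :: "'n::finite \<Rightarrow> real ^ 'd"
  defines "W \<equiv> polyhedral_product UNIV (cball 0 1) (sphere 0 1) (face_complex (assoc_polytope lam))"
  assumes adm: "admissible lam"
  shows "\<exists>R. \<forall>q\<in>ZH lam. \<forall>p. rescale lam p q \<in> W \<longrightarrow> norm p \<le> R"
proof -
  define \<psi> where "\<psi> q w p
    = (\<Sum>i\<in>UNIV. norm (q i) * max 0 (weight lam p i) + norm (w i) * max 0 (- weight lam p i))"
    for q w :: "'n \<Rightarrow> quat" and p
  \<comment> \<open>Positive for \<open>p \<noteq> 0\<close> and homogeneous in \<open>p\<close>, but at most \<open>n\<close> when \<open>w\<close> is the translate of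
    \<open>q\<close> by \<open>p\<close>, since \<open>t \<le> exp t\<close>.\<close>
  have \<psi>_nn: "norm (q i) * max 0 (weight lam p i) + norm (w i) * max 0 (- weight lam p i) \<ge> 0"
    for q w :: "'n \<Rightarrow> quat" and p i
    by simp
  have \<psi>_pos: "\<psi> q w p > 0" if q: "q \<in> ZH lam" and w: "w \<in> W" and "p \<noteq> 0" for q w p
  proof (rule ccontr)
    assume "\<not> \<psi> q w p > 0"
    moreover have "\<psi> q w p \<ge> 0"
      unfolding \<psi>_def by (intro sum_nonneg \<psi>_nn)
    ultimately have "\<psi> q w p = 0" by simp
    then have "norm (q i) * max 0 (weight lam p i) + norm (w i) * max 0 (- weight lam p i) = 0" for i
      using \<psi>_nn[of q _ p w] unfolding \<psi>_def by (subst (asm) sum_nonneg_eq_0_iff) auto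
    then have zero: "norm (q i) * max 0 (weight lam p i) = 0" "norm (w i) * max 0 (- weight lam p i) = 0" for i
      by (smt (verit) mult_nonneg_nonneg norm_ge_zero)+
    obtain x where x: "x \<in> assoc_polytope lam" "\<And>i. norm (w i) \<noteq> 1 \<Longrightarrow> x i = 0"
      using w unfolding W_def mem_moment_angle_iff by blast
    \<comment> \<open>The second summands force nonnegative weights on the support of
      \<open>x\<close>; the first force nonpositive weights where \<open>q i \<noteq> 0\<close>,
      hence \<open>snd p \<le> 0\<close>.\<close>
    have "weight lam p i \<ge> 0" if "x i \<noteq> 0" for i
      using zero(2)[of i] x(2)[of i] that by (auto simp: max_def split: if_splits)
    moreover have "(norm (q i))\<^sup>2 * weight lam p i \<le> 0" for i
      using zero(1)[of i] by (cases "q i = 0") (auto simp: max_def mult_nonneg_nonpos split: if_splits)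
    then have "snd p \<le> 0"
      unfolding sum_weight_assoc_polytope[OF ZH_imp_assoc_polytope[OF q], of p, symmetric]
      by (intro sum_nonpos)
    ultimately have "p = 0"
      by (intro weight_nonneg_imp_0[OF adm x(1)])
    with \<open>p \<noteq> 0\<close> show False by simp
  qed
  \<comment> \<open>A minimum over this compact set bounds \<open>\<psi>\<close> below uniformly in
    \<open>q\<close> and \<open>w\<close>.\<close>
  let ?C = "ZH lam \<times> W \<times> sphere (0 :: (real ^ 'd) \<times> real) 1"
  have "compact ?C"
    unfolding W_def by (intro compact_Times compact_ZH compact_polyhedral_product) auto
  moreover have "continuous_on ?C (\<lambda>(q, w, p). \<psi> q w p)"
    unfolding \<psi>_def case_prod_unfold
    by (intro continuous_intros continuous_on_product_then_coordinatewise[of _ "\<lambda>z. fst z"]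
          continuous_on_product_then_coordinatewise[of _ "\<lambda>z. fst (snd z)"])
  ultimately have "\<exists>\<epsilon>>0. \<forall>(q, w, p)\<in>?C. \<psi> q w p \<ge> \<epsilon>"
  proof (cases "?C = {}")
    case False
    assume "compact ?C" "continuous_on ?C (\<lambda>(q, w, p). \<psi> q w p)"
    then obtain z where z: "z \<in> ?C" "\<forall>z'\<in>?C. (case z of (q, w, p) \<Rightarrow> \<psi> q w p) \<le> (case z' of (q, w, p) \<Rightarrow> \<psi> q w p)"
      using continuous_attains_inf[OF _ False] by blast
    obtain q w p where [simp]: "z = (q, w, p)" by (cases z)
    have "\<psi> q w p > 0" using z(1) by (intro \<psi>_pos) auto
    with z(2) show ?thesis by (intro exI[of _ "\<psi> q w p"]) auto
  \<comment> \<open>Over an empty product the bound is vacuous, and 1 serves as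
    \<open>\<epsilon>\<close>.\<close>
  qed (auto intro: exI[of _ 1])
  then obtain \<epsilon> where \<epsilon>: "\<epsilon> > 0"
      "\<And>q w p. q \<in> ZH lam \<Longrightarrow> w \<in> W \<Longrightarrow> norm p = 1 \<Longrightarrow> \<epsilon> \<le> \<psi> q w p"
    by fastforce
  have "norm p \<le> CARD('n) / \<epsilon>" if q: "q \<in> ZH lam" and w: "rescale lam p q \<in> W" for q p
  proof (cases "p = 0")
    case False
    have q_le: "norm (q i) \<le> 1" for i using norm_le_1_if_ZH[OF q] .
    have w_le: "norm (rescale lam p q i) \<le> 1" for i
      using w by (simp add: W_def mem_moment_angle_iff del: norm_rescale)
    \<comment> \<open>Only one of the two maxima can be nonzero; its term is bounded by the norm of
      the translate or by that of \<open>q i\<close>.\<close>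
    have le1: "norm (q i) * max 0 (weight lam p i)
        + norm (rescale lam p q i) * max 0 (- weight lam p i) \<le> 1" for i
    proof (cases "weight lam p i \<ge> 0")
      case True
      have "norm (q i) * weight lam p i \<le> norm (q i) * exp (weight lam p i)"
        by (intro mult_left_mono self_le_exp) auto
      with True w_le[of i] show ?thesis by (simp add: mult.commute)
    next
      case False
      have "norm (rescale lam p q i) * (- weight lam p i)
          \<le> norm (rescale lam p q i) * exp (- weight lam p i)"
        by (intro mult_left_mono self_le_exp) auto
      also have "\<dots> = norm (q i)"
        by (simp add: exp_minus field_simps)
      finally show ?thesis
        using False q_le[of i] by (simp add: max_def)
    qed
    have "\<epsilon> * norm p \<le> \<psi> q (rescale lam p q) (p /\<^sub>R norm p) * norm p"
      using False by (intro mult_right_mono \<epsilon>(2) q w) auto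
    also have "\<dots> = \<psi> q (rescale lam p q) p"
      using False unfolding \<psi>_def sum_distrib_right
      by (intro sum.cong) (auto simp: max_def field_simps)
    also have "\<dots> \<le> CARD('n)"
      unfolding \<psi>_def using sum_bounded_above[of UNIV, OF le1] by simp
    finally show ?thesis
      using \<epsilon>(1) by (simp add: field_simps)
  qed (use \<epsilon>(1) in simp)
  then show ?thesis by blast
qed

section \<open>The equivariant homeomorphism\<close>

text \<open>Compactness of \<open>S\<close> takes the place of showing that minimisers depend
  continuously on the point: continuous bijections from \<open>S\<close> onto Hausdorff spaces have
  continuous inverses.\<close>

lemma ZH_homeomorphism_polyhedral_product:
  fixes lam :: "'n::finite \<Rightarrow> real ^ 'd"
  defines "W \<equiv> polyhedral_product UNIV (cball 0 1) (sphere 0 1) (face_complex (assoc_polytope lam))"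
  assumes adm: "admissible lam"
  obtains f g where "homeomorphism (ZH lam) W f g"
    "\<And>q u. q \<in> ZH lam \<Longrightarrow> \<forall>i. u i \<in> Sp1 \<Longrightarrow> f (right_mult q u) = right_mult (f q) u"
proof -
  define \<pi> where "\<pi> z = rescale lam (snd z) (fst z)" for z
  define S where "S = {z. fst z \<in> ZH lam \<and> \<pi> z \<in> W}"
  have \<pi>_cont: "continuous_on T \<pi>" for T
    unfolding \<pi>_def rescale_def
  proof (rule continuous_on_coordinatewise_then_product)
    fix i
    have "continuous_on T (\<lambda>z. fst z i)"
      by (rule continuous_on_product_then_coordinatewise[OF continuous_on_fst[OF continuous_on_id]])
    then show "continuous_on T (\<lambda>z. exp (weight lam (snd z) i) *\<^sub>R fst z i)"
      by (intro continuous_on_scaleR continuous_on_exp continuous_on_weight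
            continuous_on_snd continuous_on_id)
  qed
  obtain R where R: "\<And>q p. q \<in> ZH lam \<Longrightarrow> rescale lam p q \<in> W \<Longrightarrow> norm p \<le> R"
    using bounded_rescale_ZH_polyhedral_product[OF adm, folded W_def] by blast
  have "S = (ZH lam \<times> cball 0 R) \<inter> \<pi> -` W"
    using R by (auto simp: S_def \<pi>_def)
  moreover have "closed (\<pi> -` W)"
    using \<pi>_cont unfolding W_def
    by (intro closed_vimage compact_imp_closed compact_polyhedral_product) auto
  ultimately have "compact S"
    by (simp add: compact_Int_closed compact_Times compact_ZH)
  have "fst ` S = ZH lam"
  proof (intro equalityI subsetI)
    fix q assume q: "q \<in> ZH lam"
    obtain p where "rescale lam p q \<in> W"
      unfolding W_def
      by (rule rescale_into_polyhedral_product[OF adm ZH_imp_assoc_polytope[OF q]]) auto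
    with q have "(q, p) \<in> S" by (simp add: S_def \<pi>_def)
    then show "q \<in> fst ` S" by force
  qed (auto simp: S_def)
  moreover have "inj_on fst S"
  proof (rule inj_onI)
    fix z z' assume z: "z \<in> S" "z' \<in> S" "fst z = fst z'"
    \<comment> \<open>Two elements of \<open>S\<close> over the same \<open>q\<close> have images in
      \<open>W\<close> that are translates of each other.\<close>
    then have "rescale lam (snd z' - snd z) (\<pi> z) \<in> W" "\<pi> z \<in> W"
      by (auto simp: S_def \<pi>_def rescale_add)
    then have "snd z' - snd z = 0"
      unfolding W_def by (intro rescale_polyhedral_product_imp_0[OF adm])
    with z(3) show "z = z'" by (simp add: prod_eq_iff)
  qed
  ultimately obtain g1 where g1: "homeomorphism S (ZH lam) fst g1"
    using homeomorphism_compact[OF \<open>compact S\<close>, of fst] continuous_on_fst[OF continuous_on_id] by blast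
  have "\<pi> ` S = W"
  proof (intro equalityI subsetI)
    fix w assume w: "w \<in> W"
    then obtain x where x: "x \<in> assoc_polytope lam" "\<And>i. norm (w i) \<noteq> 1 \<Longrightarrow> x i = 0"
      unfolding W_def mem_moment_angle_iff by blast
    obtain p where p: "rescale lam p w \<in> ZH lam"
      by (rule rescale_into_ZH[OF adm x(1), of w]) (use x(2) in auto)
    moreover have "\<pi> (rescale lam p w, - p) = w"
      by (simp add: \<pi>_def rescale_add)
    ultimately show "w \<in> \<pi> ` S"
      using w by (intro image_eqI[of _ _ "(rescale lam p w, - p)"]) (auto simp: S_def)
  qed (auto simp: S_def)
  moreover have "inj_on \<pi> S"
  proof (rule inj_onI)
    fix z z' assume z: "z \<in> S" "z' \<in> S" "\<pi> z = \<pi> z'"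
    have *: "fst z' = rescale lam (snd z - snd z') (fst z)"
    proof -
      have "rescale lam (- snd z') (\<pi> z) = rescale lam (- snd z') (\<pi> z')"
        using z(3) by simp
      then show ?thesis by (simp add: \<pi>_def rescale_add)
    qed
    then have "snd z - snd z' = 0"
      using z by (intro rescale_ZH_imp_0[OF adm, of "fst z"]) (auto simp: S_def)
    with * show "z = z'" by (simp add: prod_eq_iff)
  qed
  ultimately obtain g2 where g2: "homeomorphism S W \<pi> g2"
    using homeomorphism_compact[OF \<open>compact S\<close> \<pi>_cont] by blast
  have "homeomorphism (ZH lam) W (\<pi> \<circ> g1) (fst \<circ> g2)"
    by (rule homeomorphism_compose[OF homeomorphism_symD[OF g1] g2])
  moreover have "(\<pi> \<circ> g1) (right_mult q u) = right_mult ((\<pi> \<circ> g1) q) u"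
    if q: "q \<in> ZH lam" and u: "\<forall>i. u i \<in> Sp1" for q u
  proof -
    have z: "g1 q \<in> S" "fst (g1 q) = q"
      using g1 q by (auto simp: homeomorphism_def)
    \<comment> \<open>Unit quaternions act without changing the real scaling factors, so the same
      parameter serves the moved point; injectivity of \<open>fst\<close> on \<open>S\<close> then
      identifies its preimage.\<close>
    let ?z = "(right_mult q u, snd (g1 q))"
    have \<pi>: "\<pi> ?z = right_mult (\<pi> (g1 q)) u"
      using z(2) by (simp add: \<pi>_def rescale_right_mult)
    moreover have "\<pi> (g1 q) \<in> W" using z(1) by (simp add: S_def)
    ultimately have "?z \<in> S"
      using right_mult_ZH[OF q u] right_mult_polyhedral_product[OF _ u] by (simp add: S_def W_def)
    then have "g1 (fst ?z) = ?z"
      using g1 unfolding homeomorphism_def by blast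
    with \<pi> show ?thesis by simp
  qed
  ultimately show thesis by (rule that)
qed

section \<open>Ghost vertices and the product decomposition\<close>

lemma polyhedral_product_iff:
  "q \<in> polyhedral_product V X A K
    \<longleftrightarrow> q \<in> extensional V \<and> (\<exists>\<sigma>\<in>K. \<forall>i\<in>V. q i \<in> (if i \<in> \<sigma> then X else A))"
  by (auto simp: polyhedral_product_def PiE_iff)

text \<open>No face meets \<open>G\<close>, so the coordinates in \<open>G\<close> range over
  \<open>A\<close> whichever face is chosen and are independent of the rest.\<close>

lemma polyhedral_product_split_ghost:
  fixes X A :: "'a::topological_space set"
  assumes G: "\<And>\<sigma>. \<sigma> \<in> K \<Longrightarrow> \<sigma> \<inter> G = {}"
  shows "homeomorphism (polyhedral_product UNIV X A K)
    ((\<Pi>\<^sub>E i\<in>G. A) \<times> polyhedral_product (- G) X A K)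
    (\<lambda>q. (restrict q G, restrict q (- G))) (\<lambda>(s, r) i. if i \<in> G then s i else r i)"
    (is "homeomorphism ?W ?T ?f ?g")
proof (rule homeomorphismI)
  have restrict_cont: "continuous_on S (\<lambda>q. restrict q V)" for V and S :: "('n \<Rightarrow> 'a) set"
  proof (rule continuous_on_coordinatewise_then_product)
    \<comment> \<open>Outside \<open>V\<close> the coordinate is the constant
      \<open>undefined\<close>.\<close>
    show "continuous_on S (\<lambda>q. restrict q V i)" for i
      by (cases "i \<in> V") (auto intro: continuous_on_product_then_coordinatewise[OF continuous_on_id])
  qed
  then show "continuous_on ?W ?f"
    by (intro continuous_on_Pair)
  show "continuous_on ?T ?g"
    unfolding case_prod_unfold
  proof (rule continuous_on_coordinatewise_then_product)
    show "continuous_on ?T (\<lambda>z. if i \<in> G then fst z i else snd z i)" for i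
      by (cases "i \<in> G")
         (simp_all add: continuous_on_product_then_coordinatewise[OF continuous_on_fst[OF continuous_on_id]]
            continuous_on_product_then_coordinatewise[OF continuous_on_snd[OF continuous_on_id]])
  qed
  show "?f ` ?W \<subseteq> ?T"
  proof (rule image_subsetI)
    fix q assume "q \<in> ?W"
    then obtain \<sigma> where \<sigma>: "\<sigma> \<in> K" "\<And>i. q i \<in> (if i \<in> \<sigma> then X else A)"
      by (auto simp: polyhedral_product_iff)
    have "q i \<in> A" if "i \<in> G" for i
      using that G[OF \<sigma>(1)] \<sigma>(2)[of i] by (cases "i \<in> \<sigma>") auto
    moreover have "restrict q (- G) \<in> polyhedral_product (- G) X A K"
      unfolding polyhedral_product_iff
      by (intro conjI bexI[OF _ \<sigma>(1)]) (use \<sigma>(2) in simp_all)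
    ultimately show "?f q \<in> ?T" by simp
  qed
  show "?g ` ?T \<subseteq> ?W"
  proof (rule image_subsetI)
    fix z assume z: "z \<in> ?T"
    then obtain \<sigma> where \<sigma>: "\<sigma> \<in> K" "\<And>i. i \<notin> G \<Longrightarrow> snd z i \<in> (if i \<in> \<sigma> then X else A)"
      by (auto simp: polyhedral_product_iff)
    have "?g z i \<in> (if i \<in> \<sigma> then X else A)" for i
      using z G[OF \<sigma>(1)] \<sigma>(2)[of i] by (cases "i \<in> G") (auto simp: PiE_iff)
    then have "\<forall>i\<in>UNIV. ?g z i \<in> (if i \<in> \<sigma> then X else A)" by (rule ballI)
    with \<sigma>(1) have "\<exists>\<sigma>\<in>K. \<forall>i\<in>UNIV. ?g z i \<in> (if i \<in> \<sigma> then X else A)" by (rule bexI[rotated])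
    then show "?g z \<in> ?W"
      unfolding polyhedral_product_iff by (rule conjI[rotated]) simp
  qed
  show "?g (?f q) = q" for q
    by auto
  show "?f (?g z) = z" if "z \<in> ?T" for z
    using that
    by (cases z) (auto simp: polyhedral_product_iff PiE_iff extensional_def restrict_def fun_eq_iff)
qed

theorem theorem7p1:
  fixes m :: nat and lam :: "'n::finite \<Rightarrow> real ^ 'd"
    and P :: "('n \<Rightarrow> real) set" and K :: "'n set set" and G :: "'n set"
  assumes "m \<ge> 1" and "CARD('d) = 4 * m"
    and "admissible lam"
    and "affine hull (range lam) = UNIV"
    and "P = assoc_polytope lam" and "K = face_complex P"
    and "G = {i. indispensable lam i}"
  shows "(\<exists>f g. homeomorphism (ZH lam) (polyhedral_product UNIV (cball 0 1) (sphere 0 1) K) f g \<and>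
            (\<forall>q\<in>ZH lam. \<forall>u. (\<forall>i. u i \<in> Sp1) \<longrightarrow> f (right_mult q u) = right_mult (f q) u)) \<and>
         (\<forall>i. indispensable lam i \<longleftrightarrow> ghost_vertex K i) \<and>
         homeomorphism
           (polyhedral_product UNIV (cball 0 1) (sphere 0 1) K)
           ((\<Pi>\<^sub>E i\<in>G. sphere (0::quat) 1) \<times> polyhedral_product (- G) (cball 0 1) (sphere 0 1) K)
           (\<lambda>q. (restrict q G, restrict q (- G)))
           (\<lambda>(s, r) i. if i \<in> G then s i else r i)"
proof (intro conjI allI)
  have K: "K = face_complex (assoc_polytope lam)"
    using assms(5,6) by simp
  show "\<exists>f g. homeomorphism (ZH lam) (polyhedral_product UNIV (cball 0 1) (sphere 0 1) K) f g \<and>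
      (\<forall>q\<in>ZH lam. \<forall>u. (\<forall>i. u i \<in> Sp1) \<longrightarrow> f (right_mult q u) = right_mult (f q) u)"
    unfolding K using ZH_homeomorphism_polyhedral_product[OF assms(3)] by metis
  show "indispensable lam i \<longleftrightarrow> ghost_vertex K i" for i
  proof -
    \<comment> \<open>Coordinates on the polytope are nonnegative, so being positive throughout
      means that no polytope point witnesses \<open>{i}\<close> as a face.\<close>
    have "x i > 0 \<longleftrightarrow> x i \<noteq> 0" if "x \<in> assoc_polytope lam" for x
      using that by (simp add: assoc_polytope_def less_le)
    then show ?thesis
      by (auto simp: K indispensable_def ghost_vertex_def face_complex_def)
  qed
  \<comment> \<open>A face through an indispensable index would give a polytope point vanishing
    there.\<close>
  have "\<sigma> \<inter> G = {}" if "\<sigma> \<in> K" for \<sigma>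
    using that assms(7) by (force simp: K face_complex_def indispensable_def)
  then show "homeomorphism
      (polyhedral_product UNIV (cball 0 1) (sphere 0 1) K)
      ((\<Pi>\<^sub>E i\<in>G. sphere (0::quat) 1) \<times> polyhedral_product (- G) (cball 0 1) (sphere 0 1) K)
      (\<lambda>q. (restrict q G, restrict q (- G)))
      (\<lambda>(s, r) i. if i \<in> G then s i else r i)"
    by (rule polyhedral_product_split_ghost)
qed

end
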